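(* Let $X$ and $Y$ be Banach spaces such that $X^*$ and $Y$ are separable. If $X$ or $Y$ has the $\lambda$-RMAP for some $\lambda>1$, then $B(X,Y)$ (with the operator norm) has the UBCP.
   Context: $B(X,Y)$ is the space of bounded linear operators from $X$ to $Y$. Approximating sequence on a Banach space $W$: a sequence $\{S_n\}_{n=1}^\infty$ of bounded finite rank operators on $W$ converging strongly (pointwise in norm) to the identity, with $S_mS_n=S_n$ for all $n<m$ (and hence $\limsup_n\|S_n\|<\infty$). $\lambda$-RMAP ($\lambda$-reverse metric approximation property, $\lambda>0$): a separable Banach space $W$ has it if there is an approximating sequence $\{S_n\}$ on $W$ with $\lim_n\|id_W-\lambda S_n\|=1$. UBCP (uniform ball-covering property): a normed space $Z$ has it if there exist $r>0$, $\delta>0$ and countably many closed balls $B(z_n,r_n)$ in $Z$ whose union contains the unit sphere of $Z$, with $r_n<\|z_n\|$, $r_n\le r$ and $B(z_n,r_n)\cap B(0,\delta)=\emptyset$ for all $n$. *)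

theory Defs
  imports "HOL-Analysis.Analysis"
begin

text \<open>
  All normed spaces are over the reals and are represented by types; \<open>B(X,Y)\<close> with the operator
  norm is the type of bounded linear functions \<open>'a \<Rightarrow>\<^sub>L 'b\<close>, and the dual space is
  \<open>'a \<Rightarrow>\<^sub>L real\<close>. Properties of a space are predicates on the \<open>itself\<close> token of its type.
\<close>

definition separable :: "'a::topological_space itself \<Rightarrow> bool" where
  "separable _ \<longleftrightarrow> separable_space (euclidean :: 'a topology)"

text \<open>The library's \<open>dim\<close> is 0 on infinite-dimensional sets, hence the formulation with \<open>span\<close>.\<close>

definition finite_rank :: "('a::real_normed_vector \<Rightarrow>\<^sub>L 'b::real_normed_vector) \<Rightarrow> bool" where
  "finite_rank T \<longleftrightarrow> (\<exists>F. finite F \<and> range (blinfun_apply T) \<subseteq> span F)"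

definition approximating_sequence :: "(nat \<Rightarrow> ('w::banach \<Rightarrow>\<^sub>L 'w)) \<Rightarrow> bool" where
  "approximating_sequence S \<longleftrightarrow>
     (\<forall>n. finite_rank (S n)) \<and>
     (\<forall>x. (\<lambda>n. blinfun_apply (S n) x) \<longlonglongrightarrow> x) \<and>
     (\<forall>m n. n < m \<longrightarrow> S m o\<^sub>L S n = S n)"

definition RMAP :: "real \<Rightarrow> 'w::banach itself \<Rightarrow> bool" where
  "RMAP c W \<longleftrightarrow> 0 < c \<and> separable W \<and>
     (\<exists>S :: nat \<Rightarrow> ('w \<Rightarrow>\<^sub>L 'w). approximating_sequence S \<and>
        (\<lambda>n. norm (id_blinfun - c *\<^sub>R S n)) \<longlonglongrightarrow> 1)"

text \<open>
  A family of balls is a set of pairs of a centre and a (positive) radius. It may be finite or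
  empty; the latter is needed only for the zero space, whose unit sphere is empty.
\<close>

definition UBCP :: "'z::real_normed_vector itself \<Rightarrow> bool" where
  "UBCP _ \<longleftrightarrow> (\<exists>r>0. \<exists>\<delta>>0. \<exists>C :: ('z \<times> real) set. countable C \<and>
     sphere 0 1 \<subseteq> (\<Union>(z, \<rho>)\<in>C. cball z \<rho>) \<and>
     (\<forall>(z, \<rho>)\<in>C. 0 < \<rho> \<and> \<rho> < norm z \<and> \<rho> \<le> r \<and> cball z \<rho> \<inter> cball 0 \<delta> = {}))"

end

theory Submission
  imports Defs
begin

text \<open>
  If \<open>U\<^sub>n\<close> is \<open>S\<^sub>n T\<close> (RMAP of \<open>Y\<close>) or \<open>T S\<^sub>n\<close> (RMAP of \<open>X\<close>) for an operator \<open>T\<close> of norm one, then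
  \<open>limsup \<parallel>T - c U\<^sub>n\<parallel> \<le> 1\<close>, while \<open>U\<^sub>n \<rightarrow> T\<close> pointwise forces \<open>liminf \<parallel>c U\<^sub>n\<parallel> \<ge> c > 1\<close>.  So \<open>T\<close> lies
  in a ball of radius about 1 around \<open>c U\<^sub>n\<close> that stays uniformly away from 0.  The centres have
  finite rank, and the finite rank operators form a separable set because \<open>X\<^sup>*\<close> and \<open>Y\<close> are
  separable, so the centres can be moved into a countable set.
\<close>

lemma separable_iff_closure:
  "separable TYPE('a::topological_space) \<longleftrightarrow> (\<exists>D :: 'a set. countable D \<and> closure D = UNIV)"
  by (simp add: separable_def separable_space_def)

subsection \<open>Finite rank operators\<close>

text \<open>Induction on \<open>B\<close>: adjoining \<open>a\<close> adds the compact segment of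
  multiples of \<open>a\<close> to a compact set. Below, compactness serves to make this set
  closed.\<close>

lemma compact_bounded_coefficients:
  fixes B :: "'a::real_normed_vector set"
  assumes "finite B"
  shows "compact {\<Sum>b\<in>B. u b *\<^sub>R b |u. \<forall>b\<in>B. \<bar>u b\<bar> \<le> M}"
  using assms
proof induction
  case empty
  then show ?case by simp
next
  case (insert a B)
  let ?C = "{\<Sum>b\<in>B. u b *\<^sub>R b |u. \<forall>b\<in>B. \<bar>u b\<bar> \<le> M}"
  have "compact ((\<lambda>t. t *\<^sub>R a) ` {-M..M})"
    by (intro compact_continuous_image continuous_intros compact_Icc)
  then have "compact {x + y |x y. x \<in> (\<lambda>t. t *\<^sub>R a) ` {-M..M} \<and> y \<in> ?C}"
    using insert.IH by (rule compact_sums)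
  also have "{x + y |x y. x \<in> (\<lambda>t. t *\<^sub>R a) ` {-M..M} \<and> y \<in> ?C} =
    {\<Sum>b\<in>insert a B. u b *\<^sub>R b |u. \<forall>b\<in>insert a B. \<bar>u b\<bar> \<le> M}" (is "?L = ?R")
  proof (intro equalityI subsetI)
    fix z assume "z \<in> ?L"
    then obtain t u where tu: "z = t *\<^sub>R a + (\<Sum>b\<in>B. u b *\<^sub>R b)" "\<bar>t\<bar> \<le> M" "\<forall>b\<in>B. \<bar>u b\<bar> \<le> M"
      by auto
    have "(\<Sum>b\<in>B. (u(a := t)) b *\<^sub>R b) = (\<Sum>b\<in>B. u b *\<^sub>R b)"
      using insert.hyps by (intro sum.cong) auto
    then have "z = (\<Sum>b\<in>insert a B. (u(a := t)) b *\<^sub>R b)"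
      using tu insert.hyps by simp
    moreover have "\<forall>b\<in>insert a B. \<bar>(u(a := t)) b\<bar> \<le> M"
      using tu by auto
    ultimately show "z \<in> ?R" by blast
  next
    fix z assume "z \<in> ?R"
    then obtain u where u: "z = (\<Sum>b\<in>insert a B. u b *\<^sub>R b)" "\<forall>b\<in>insert a B. \<bar>u b\<bar> \<le> M"
      by blast
    then have "z = u a *\<^sub>R a + (\<Sum>b\<in>B. u b *\<^sub>R b)" "u a \<in> {-M..M}"
      using insert.hyps by (auto simp: abs_le_iff)
    then show "z \<in> ?L" using u by blast
  qed
  finally show ?case .
qed

text \<open>Induction on \<open>B\<close>: the positive distance from a new vector \<open>a\<close>
  to \<open>span B\<close> controls the coefficient of \<open>a\<close>, and the induction
  hypothesis then controls the others. The bound makes coordinates with respect to \<open>B\<close>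
  continuous.\<close>

lemma independent_coefficient_bound:
  fixes B :: "'a::real_normed_vector set"
  assumes "finite B" "independent B"
  shows "\<exists>K>0. \<forall>u. \<forall>b\<in>B. \<bar>u b\<bar> \<le> K * norm (\<Sum>b\<in>B. u b *\<^sub>R b)"
  using assms
proof induction
  case empty
  then show ?case by (auto intro: exI[of _ 1])
next
  case (insert a B)
  from insert.prems insert.hyps have ind: "independent B" and a: "a \<notin> span B"
    by (auto simp: independent_insert)
  obtain K where K: "K > 0" "\<And>u b. b \<in> B \<Longrightarrow> \<bar>u b\<bar> \<le> K * norm (\<Sum>b\<in>B. u b *\<^sub>R b)"
    using insert.IH[OF ind] by blast
  \<comment> \<open>With this \<open>M\<close>, every vector of \<open>span B\<close> of norm at
    most \<open>norm a + 1\<close> lies in \<open>C\<close>, and all other vectors of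
    \<open>span B\<close> are farther than 1 from \<open>a\<close>. So the minimum \<open>d\<close>
    of 1 and the radius \<open>e\<close> of a ball around \<open>a\<close> missing \<open>C\<close>
    bounds the distance from \<open>a\<close> to \<open>span B\<close> below.\<close>
  define M where "M = K * (norm a + 1)"
  define C where "C = {\<Sum>b\<in>B. u b *\<^sub>R b |u. \<forall>b\<in>B. \<bar>u b\<bar> \<le> M}"
  have "closed C"
    unfolding C_def using compact_bounded_coefficients[OF insert.hyps(1)] compact_imp_closed by blast
  moreover have "a \<notin> C"
    using a by (auto simp: C_def intro: span_sum span_scale span_base)
  ultimately obtain e where e: "e > 0" "ball a e \<subseteq> - C"
    using open_contains_ball[of "- C"] by auto
  define d where "d = min e 1"
  have d: "d > 0" using e by (simp add: d_def)
  have dist: "d \<le> norm (a + (\<Sum>b\<in>B. u b *\<^sub>R b))" for u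
  proof (rule ccontr)
    let ?v = "\<Sum>b\<in>B. - u b *\<^sub>R b"
    assume "\<not> ?thesis"
    then have *: "norm (a - ?v) < d"
      by (simp add: sum_negf)
    then have "norm (a - ?v) < 1"
      by (simp add: d_def)
    then have "norm ?v \<le> norm a + 1"
      using norm_triangle_ineq3[of a ?v] by linarith
    then have "K * norm ?v \<le> M"
      using K(1) by (simp add: M_def)
    then have "?v \<in> C"
      unfolding C_def using K(2)[of _ "\<lambda>b. - u b"] by (force intro!: exI[of _ "\<lambda>b. - u b"])
    then show False
      using e(2) * by (fastforce simp: dist_norm d_def)
  qed
  \<comment> \<open>The summand \<open>1 / d\<close> serves the coefficient of \<open>a\<close>; the
    other serves \<open>B\<close>, where the induction hypothesis is applied to \<open>?v\<close>,
    that is \<open>?w\<close> minus its \<open>a\<close>-component.\<close>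
  define L where "L = 1 / d + K * (1 + norm a / d)"
  have L: "L > 0" using d K by (simp add: L_def add_pos_nonneg)
  have "\<bar>u b\<bar> \<le> L * norm (\<Sum>b\<in>insert a B. u b *\<^sub>R b)" if b: "b \<in> insert a B" for u b
  proof -
    let ?v = "\<Sum>b\<in>B. u b *\<^sub>R b" and ?w = "\<Sum>b\<in>insert a B. u b *\<^sub>R b"
    have w: "?w = u a *\<^sub>R a + ?v" using insert.hyps by simp
    have ua: "\<bar>u a\<bar> \<le> norm ?w / d"
    proof (cases "u a = 0")
      case False
      \<comment> \<open>Dividing by \<open>u a\<close> makes the coefficient of \<open>a\<close>
        equal to 1, so that \<open>dist\<close> applies.\<close>
      then have "?w = u a *\<^sub>R (a + (\<Sum>b\<in>B. (u b / u a) *\<^sub>R b))"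
        by (simp add: w scaleR_add_right scaleR_sum_right)
      then have "norm ?w = \<bar>u a\<bar> * norm (a + (\<Sum>b\<in>B. (u b / u a) *\<^sub>R b))"
        by (metis norm_scaleR)
      also have "\<dots> \<ge> \<bar>u a\<bar> * d"
        by (intro mult_left_mono dist) auto
      finally show ?thesis using d by (simp add: field_simps)
    qed (use d in simp)
    show ?thesis
    proof (cases "b = a")
      case True
      have "norm ?w / d \<le> L * norm ?w"
        using d K(1) by (simp add: L_def algebra_simps)
      then show ?thesis using ua True by simp
    next
      case False
      have "norm ?v = norm (?w - u a *\<^sub>R a)" by (simp add: w)
      also have "\<dots> \<le> norm ?w + \<bar>u a\<bar> * norm a"
        using norm_triangle_ineq4[of ?w "u a *\<^sub>R a"] by simp
      also have "\<dots> \<le> norm ?w + norm ?w / d * norm a"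
        using ua by (intro add_left_mono mult_right_mono) auto
      finally have "K * norm ?v \<le> K * (norm ?w + norm ?w / d * norm a)"
        using K(1) by simp
      also have "\<dots> \<le> L * norm ?w"
        using d by (simp add: L_def algebra_simps)
      finally show ?thesis using K(2)[of b u] b False by force
    qed
  qed
  then show ?case using L by blast
qed

text \<open>The elementary tensor of \<open>f\<close> and \<open>y\<close>, written as a composition
  so that joint continuity in \<open>f\<close> and \<open>y\<close> follows from that of
  \<open>o\<^sub>L\<close>.\<close>

definition rank_one :: "('a::real_normed_vector \<Rightarrow>\<^sub>L real) \<Rightarrow> 'b::real_normed_vector \<Rightarrow> 'a \<Rightarrow>\<^sub>L 'b" where
  "rank_one f y = blinfun_scaleR_left y o\<^sub>L f"

lemma rank_one_apply [simp]: "rank_one f y x = f x *\<^sub>R y"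
  by (simp add: rank_one_def)

lemma continuous_on_rank_one [continuous_intros]:
  assumes "continuous_on S f" "continuous_on S g"
  shows "continuous_on S (\<lambda>x. rank_one (f x) (g x))"
  unfolding rank_one_def
  by (intro bounded_bilinear.continuous_on[OF bounded_bilinear_blinfun_compose]
    bounded_linear.continuous_on[OF bounded_linear_blinfun_scaleR_left] assms)

text \<open>The coordinates of \<open>T x\<close> in a basis of a finite-dimensional space
  containing the range are linear in \<open>x\<close>, and bounded by the coefficient bound.\<close>

lemma finite_rank_sum:
  fixes T :: "'a::real_normed_vector \<Rightarrow>\<^sub>L 'b::real_normed_vector"
  assumes "finite_rank T"
  obtains B f where "finite B" "T = (\<Sum>b\<in>B. rank_one (f b) b)"
proof -
  obtain F where F: "finite F" "range (blinfun_apply T) \<subseteq> span F"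
    using assms by (auto simp: finite_rank_def)
  obtain B where B: "B \<subseteq> F" "independent B" "F \<subseteq> span B"
    by (rule maximal_independent_subset)
  have finB: "finite B" using B F finite_subset by blast
  have "span F \<subseteq> span B"
    using B(3) by (rule span_minimal) simp
  then have T: "T x \<in> span B" for x using F by blast
  have repr: "(\<Sum>b\<in>B. representation B (T x) b *\<^sub>R b) = T x" for x
    by (rule sum_representation_eq) (use B finB T in auto)
  obtain K where K: "\<And>u b. b \<in> B \<Longrightarrow> \<bar>u b\<bar> \<le> K * norm (\<Sum>b\<in>B. u b *\<^sub>R b)"
    using independent_coefficient_bound[OF finB B(2)] by metis
  define g where "g b x = representation B (T x) b" for b x
  have g: "bounded_linear (g b)" if "b \<in> B" for b
  proof (rule bounded_linear_intro)
    show "norm (g b x) \<le> norm x * (norm T * max K 0)" for x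
    proof -
      have "norm (g b x) \<le> K * norm (T x)"
        using K[OF that, of "representation B (T x)"] by (simp add: g_def repr)
      \<comment> \<open>The sign of \<open>K\<close> was not recorded when it was obtained;
        \<open>max K 0\<close> is a nonnegative factor.\<close>
      also have "\<dots> \<le> max K 0 * norm (T x)" by (intro mult_right_mono) auto
      also have "\<dots> \<le> max K 0 * (norm T * norm x)"
        by (intro mult_left_mono norm_blinfun) auto
      finally show ?thesis by (simp add: algebra_simps)
    qed
  qed (use B T in \<open>simp_all add: g_def blinfun.bilinear_simps representation_add representation_scale\<close>)
  show ?thesis
  proof
    show "T = (\<Sum>b\<in>B. rank_one (Blinfun (g b)) b)"
      by (rule blinfun_eqI)
        (simp add: blinfun.sum_left bounded_linear_Blinfun_apply[OF g] g_def repr)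
  qed (fact finB)
qed

lemma finite_rank_scaleR:
  assumes "finite_rank T" shows "finite_rank (c *\<^sub>R T)"
proof -
  obtain F where "finite F" "range (blinfun_apply T) \<subseteq> span F"
    using assms by (auto simp: finite_rank_def)
  then show ?thesis
    unfolding finite_rank_def
    by (intro exI[of _ F]) (auto simp: blinfun.scaleR_left intro!: span_scale)
qed

lemma finite_rank_compose_left:
  assumes "finite_rank S" shows "finite_rank (S o\<^sub>L T)"
  using assms by (fastforce simp: finite_rank_def)

lemma finite_rank_compose_right:
  assumes "finite_rank S" shows "finite_rank (T o\<^sub>L S)"
proof -
  obtain F where F: "finite F" "range (blinfun_apply S) \<subseteq> span F"
    using assms by (auto simp: finite_rank_def)
  have "range (blinfun_apply (T o\<^sub>L S)) \<subseteq> span (blinfun_apply T ` F)"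
    using F(2) by (auto simp: linear_span_image[OF bounded_linear.linear[OF blinfun.bounded_linear_right]])
  then show ?thesis using F(1) unfolding finite_rank_def by blast
qed

text \<open>Sums of tensors from countable dense sets of functionals and vectors form a countable
  \<open>D\<close>. By continuity its closure is stable under addition and contains all rank one
  operators, hence all their finite sums.\<close>

lemma finite_rank_separable:
  assumes "separable TYPE('a::real_normed_vector \<Rightarrow>\<^sub>L real)"
    and "separable TYPE('b::real_normed_vector)"
  obtains D :: "('a::real_normed_vector \<Rightarrow>\<^sub>L 'b::real_normed_vector) set"
  where "countable D" "\<And>T. finite_rank T \<Longrightarrow> T \<in> closure D"
proof -
  obtain P :: "('a \<Rightarrow>\<^sub>L real) set" and Q :: "'b set"
    where P: "countable P" "closure P = UNIV" and Q: "countable Q" "closure Q = UNIV"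
    using assms unfolding separable_iff_closure by blast
  \<comment> \<open>Lists keep the family countable and turn addition into concatenation.\<close>
  define s where "s = (\<lambda>xs :: (('a \<Rightarrow>\<^sub>L real) \<times> 'b) list. \<Sum>(f, y)\<leftarrow>xs. rank_one f y)"
  define D where "D = s ` lists (P \<times> Q)"
  have cD: "countable D"
    unfolding D_def using P Q by (intro countable_image countable_lists countable_SIGMA) auto
  have add: "S + T \<in> closure D" if ST: "S \<in> closure D" "T \<in> closure D" for S T
  proof -
    have "S + T \<in> D" if D: "S \<in> D" "T \<in> D" for S T
    proof -
      obtain xs ys where "xs \<in> lists (P \<times> Q)" "ys \<in> lists (P \<times> Q)" "S = s xs" "T = s ys"
        using D unfolding D_def by blast
      then show ?thesis
        unfolding D_def by (intro image_eqI[of _ _ "xs @ ys"]) (auto simp: s_def)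
    qed
    then have "(\<lambda>(S, T). S + T) ` closure (D \<times> D) \<subseteq> closure D"
      by (intro image_closure_subset)
        (auto simp: case_prod_beta intro!: continuous_intros subsetD[OF closure_subset])
    then show ?thesis using ST by (auto simp: closure_Times)
  qed
  have elem: "rank_one f y \<in> closure D" for f y
  proof -
    have "rank_one f y \<in> D" if "f \<in> P" "y \<in> Q" for f y
      unfolding D_def using that by (intro image_eqI[of _ _ "[(f, y)]"]) (auto simp: s_def)
    then have "(\<lambda>(f, y). rank_one f y) ` closure (P \<times> Q) \<subseteq> closure D"
      by (intro image_closure_subset)
        (auto simp: case_prod_beta intro!: continuous_intros subsetD[OF closure_subset])
    then show ?thesis using P Q by (auto simp: closure_Times)
  qed
  have "0 \<in> D" unfolding D_def by (intro image_eqI[of _ _ "[]"]) (auto simp: s_def)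
  then have zero: "0 \<in> closure D" using closure_subset by blast
  \<comment> \<open>For infinite \<open>B\<close> the sum is 0 by convention, which
    \<open>zero\<close> covers.\<close>
  have sum: "(\<Sum>b\<in>B. rank_one (f b) b) \<in> closure D" for f :: "'b \<Rightarrow> ('a \<Rightarrow>\<^sub>L real)" and B
    by (induction B rule: infinite_finite_induct) (auto simp: zero intro: add elem)
  show ?thesis
  proof
    show "T \<in> closure D" if "finite_rank T" for T
      using finite_rank_sum[OF that] sum by metis
  qed (fact cD)
qed

subsection \<open>Covering the unit sphere\<close>

text \<open>Lower semicontinuity of the norm: a single vector \<open>x\<close> on which
  \<open>T\<close> stretches by more than \<open>a\<close> also witnesses the bound for almost all
  \<open>U n\<close>.\<close>

lemma norm_liminf:
  fixes T :: "'a::real_normed_vector \<Rightarrow>\<^sub>L 'b::real_normed_vector" and U :: "nat \<Rightarrow> 'a \<Rightarrow>\<^sub>L 'b"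
  assumes lim: "\<And>x. (\<lambda>n. U n x) \<longlonglongrightarrow> T x" and "a < norm T"
  shows "\<forall>\<^sub>F n in sequentially. a < norm (U n)"
proof (cases "a < 0")
  case False
  obtain x where x: "a * norm x < norm (T x)"
    using norm_blinfun_bound[of a T] False \<open>a < norm T\<close> by (meson not_le)
  have "\<forall>\<^sub>F n in sequentially. a * norm x < norm (U n x)"
    using tendsto_norm[OF lim] x by (rule order_tendstoD(1))
  then show ?thesis
  proof eventually_elim
    case (elim n)
    then have "a * norm x < norm (U n) * norm x"
      using norm_blinfun[of "U n" x] by linarith
    then show ?case by (simp add: mult_less_cancel_right)
  qed
qed (auto intro!: always_eventually intro: less_le_trans[OF _ norm_ge_zero])

text \<open>The argument shared by both cases. The number \<open>e\<close> depends only on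
  \<open>c\<close>, so one radius and one gap at 0 serve every \<open>T\<close> on the unit
  sphere.\<close>

lemma UBCP_I:
  fixes D :: "('a::real_normed_vector \<Rightarrow>\<^sub>L 'b::real_normed_vector) set"
  assumes D: "countable D" and c: "c > 1" and q: "q \<longlonglongrightarrow> 1"
    and ex: "\<And>T :: 'a \<Rightarrow>\<^sub>L 'b. norm T = 1 \<Longrightarrow> \<exists>U. (\<forall>n. c *\<^sub>R U n \<in> closure D) \<and>
      (\<forall>x. (\<lambda>n. blinfun_apply (U n) x) \<longlonglongrightarrow> blinfun_apply T x) \<and> (\<forall>n. norm (T - c *\<^sub>R U n) \<le> q n)"
  shows "UBCP TYPE('a \<Rightarrow>\<^sub>L 'b)"
proof -
  \<comment> \<open>chosen so that \<open>c (1 - e) - e > (1 + 2 e) + e\<close>\<close>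
  define e where "e = (c - 1) / (c + 5)"
  have e: "e > 0"
    using c by (simp add: e_def)
  have "e * (c + 5) = c - 1"
    using c by (simp add: e_def)
  then have e': "c * (1 - e) - e > 1 + 3 * e"
    using e by (simp add: algebra_simps)
  \<comment> \<open>The radius adds \<open>1 + e\<close>, bounding the distance from
    \<open>T\<close> to \<open>c *\<^sub>R U n\<close>, and \<open>e\<close> for moving the centre
    into \<open>D\<close>. The norm threshold is this radius plus the gap \<open>e\<close> around
    0.\<close>
  define C where "C = (\<lambda>z. (z, 1 + 2 * e)) ` {z \<in> D. norm z > 1 + 3 * e}"
  have cov: "\<exists>z\<in>D. norm z > 1 + 3 * e \<and> dist z T \<le> 1 + 2 * e" if T: "norm T = 1" for T
  proof -
    obtain U :: "nat \<Rightarrow> 'a \<Rightarrow>\<^sub>L 'b" where U: "\<And>n. c *\<^sub>R U n \<in> closure D" "\<And>x. (\<lambda>n. U n x) \<longlonglongrightarrow> T x"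
        "\<And>n. norm (T - c *\<^sub>R U n) \<le> q n"
      using ex[OF T] by blast
    have "\<forall>\<^sub>F n in sequentially. 1 - e < norm (U n)"
      by (rule norm_liminf[OF U(2)]) (use T e in simp)
    moreover have "\<forall>\<^sub>F n in sequentially. q n < 1 + e"
      using order_tendstoD(2)[OF q] e by simp
    ultimately obtain n where n: "1 - e < norm (U n)" "q n < 1 + e"
      using eventually_happens'[OF sequentially_bot eventually_conj] by blast
    obtain z where z: "z \<in> D" "dist z (c *\<^sub>R U n) < e"
      using U(1) e unfolding closure_approachable by blast
    have "c * (1 - e) \<le> norm (c *\<^sub>R U n)"
      using n c by simp
    also have "\<dots> \<le> norm z + e"
      using norm_triangle_sub[of "c *\<^sub>R U n" z] z(2) by (simp add: dist_norm norm_minus_commute)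
    finally have "norm z > 1 + 3 * e" using e' by linarith
    moreover have "dist z T \<le> 1 + 2 * e"
      using dist_triangle[of z T "c *\<^sub>R U n"] z(2) n(2) U(3)[of n]
      by (simp add: dist_norm norm_minus_commute)
    ultimately show ?thesis using z(1) by blast
  qed
  have "cball z (1 + 2 * e) \<inter> cball 0 e = {}" if "norm z > 1 + 3 * e" for z :: "'a \<Rightarrow>\<^sub>L 'b"
  proof -
    have "False" if "dist z x \<le> 1 + 2 * e" "norm x \<le> e" for x
      using norm_triangle_sub[of z x] that \<open>norm z > 1 + 3 * e\<close> by (simp add: dist_norm)
    then show ?thesis by auto
  qed
  then have "\<forall>(z, \<rho>)\<in>C. 0 < \<rho> \<and> \<rho> < norm z \<and> \<rho> \<le> 1 + 2 * e \<and> cball z \<rho> \<inter> cball 0 e = {}"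
    using e by (auto simp: C_def)
  moreover have "sphere 0 1 \<subseteq> (\<Union>(z, \<rho>)\<in>C. cball z \<rho>)"
    using cov by (fastforce simp: C_def)
  moreover have "countable C"
    unfolding C_def using D by (intro countable_image) (rule countable_subset[of _ D], auto)
  ultimately show ?thesis
    unfolding UBCP_def using e
    by (intro exI[of _ "1 + 2 * e"] exI[of _ e] exI[of _ C] conjI) auto
qed

theorem corollary1p4:
  assumes "separable TYPE('a::banach \<Rightarrow>\<^sub>L real)"
    and "separable TYPE('b::banach)"
    and "(\<exists>c>1. RMAP c TYPE('a)) \<or> (\<exists>c>1. RMAP c TYPE('b))"
  shows "UBCP TYPE('a \<Rightarrow>\<^sub>L 'b)"
proof -
  obtain D :: "('a \<Rightarrow>\<^sub>L 'b) set" where D: "countable D" "\<And>T. finite_rank T \<Longrightarrow> T \<in> closure D"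
    using finite_rank_separable[OF assms(1,2)] by blast
  from assms(3) show ?thesis
  proof (elim disjE exE conjE)
    fix c :: real assume c: "c > 1" and "RMAP c TYPE('a)"
    then obtain S :: "nat \<Rightarrow> ('a \<Rightarrow>\<^sub>L 'a)" where S: "\<And>n. finite_rank (S n)"
        "\<And>x. (\<lambda>n. S n x) \<longlonglongrightarrow> x" "(\<lambda>n. norm (id_blinfun - c *\<^sub>R S n)) \<longlonglongrightarrow> 1"
      by (auto simp: RMAP_def approximating_sequence_def)
    show ?thesis
    proof (rule UBCP_I[OF D(1) c S(3)], intro exI conjI allI)
      fix T :: "'a \<Rightarrow>\<^sub>L 'b" assume T: "norm T = 1"
      \<comment> \<open>Unification with this goal fixes the witness \<open>U n\<close> as
        \<open>T o\<^sub>L S n\<close>.\<close>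
      show "c *\<^sub>R (T o\<^sub>L S n) \<in> closure D" for n
        by (intro D finite_rank_scaleR finite_rank_compose_right S)
      show "(\<lambda>n. (T o\<^sub>L S n) x) \<longlonglongrightarrow> T x" for x
        by (auto intro!: tendsto_intros S)
      show "norm (T - c *\<^sub>R (T o\<^sub>L S n)) \<le> norm (id_blinfun - c *\<^sub>R S n)" for n
      proof -
        \<comment> \<open>Factoring out \<open>T\<close>, of norm 1, leaves the operator from the
          RMAP of the domain.\<close>
        have "T - c *\<^sub>R (T o\<^sub>L S n) = T o\<^sub>L (id_blinfun - c *\<^sub>R S n)"
          by (rule blinfun_eqI) (simp add: blinfun.bilinear_simps)
        then show ?thesis
          using norm_blinfun_compose[of T "id_blinfun - c *\<^sub>R S n"] T by simp
      qed
    qed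
  next
    fix c :: real assume c: "c > 1" and "RMAP c TYPE('b)"
    then obtain S :: "nat \<Rightarrow> ('b \<Rightarrow>\<^sub>L 'b)" where S: "\<And>n. finite_rank (S n)"
        "\<And>x. (\<lambda>n. S n x) \<longlonglongrightarrow> x" "(\<lambda>n. norm (id_blinfun - c *\<^sub>R S n)) \<longlonglongrightarrow> 1"
      by (auto simp: RMAP_def approximating_sequence_def)
    show ?thesis
    proof (rule UBCP_I[OF D(1) c S(3)], intro exI conjI allI)
      fix T :: "'a \<Rightarrow>\<^sub>L 'b" assume T: "norm T = 1"
      \<comment> \<open>Here the witness is \<open>S n o\<^sub>L T\<close>, and \<open>T\<close>
        factors out on the right.\<close>
      show "c *\<^sub>R (S n o\<^sub>L T) \<in> closure D" for n
        by (intro D finite_rank_scaleR finite_rank_compose_left S)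
      show "(\<lambda>n. (S n o\<^sub>L T) x) \<longlonglongrightarrow> T x" for x
        by (simp add: S)
      show "norm (T - c *\<^sub>R (S n o\<^sub>L T)) \<le> norm (id_blinfun - c *\<^sub>R S n)" for n
      proof -
        have "T - c *\<^sub>R (S n o\<^sub>L T) = (id_blinfun - c *\<^sub>R S n) o\<^sub>L T"
          by (rule blinfun_eqI) (simp add: blinfun.bilinear_simps)
        then show ?thesis
          using norm_blinfun_compose[of "id_blinfun - c *\<^sub>R S n" T] T by simp
      qed
    qed
  qed
qed

end
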